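(* Let $f:[\ell,u]\to\mathbb R$ be a nonlinear, bounded and differentiable univariate function that admits a base partition $p_f^0$, and let $p_0=p_f^0,p_1,p_2,\dots$ be any infinite sequence of partitions of $[\ell,u]$ generated by the maximal-bound interval-bisection procedure. Let $\varepsilon(\mathcal R(f,p_k))$ denote the strength of the relaxation associated with $p_k$. Then $$\lim_{k\to\infty}\varepsilon(\mathcal R(f,p_k))=0.$$
   Context: Function: $f:[\ell,u]\to\mathbb R$ ($\ell<u$) is nonlinear (not affine), bounded and differentiable on $[\ell,u]$ (one-sided derivatives at the endpoints). Partitions: a partition $p$ of $[\ell,u]$ is a finite sequence $(x_0,\dots,x_k)$ with $\ell=x_0<x_1<\dots<x_k=u$; $\mathcal P(p)=\{x_0,\dots,x_k\}$; the intervals $[x_{i-1},x_i]$, $i=1,\dots,k$, are its sub-intervals. A break point of $f$ is a point of $[\ell,u]$ at which $f$ changes from convex to concave or vice versa. A base partition $p_f^0$ of $f$ is a partition such that (i) every break point of $f$ is in $\mathcal P(p_f^0)$, (ii) $f'(x_{i-1})\ne f'(x_i)$ for every sub-interval $[x_{i-1},x_i]$, and (iii) $|\mathcal P(p_f^0)|$ is minimum. To make it unique, one takes the break points of $f$ together with $\ell,u$, and adds the midpoint of every resulting sub-interval at whose endpoints $f'$ takes equal values. It is assumed that $f$ has such a (finite) base partition and that $f$ is convex or concave on each of its sub-intervals. Strength: let $p=(x_0,\dots,x_k)$ be $p_f^0$ or a partition obtained from it by inserting further points. Put $h_i(x)=f(x_i)+f'(x_i)(x-x_i)$. On $[x_{i-1},x_i]$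 let $t_i(x)=\max\{h_{i-1}(x),h_i(x)\}$ if $f$ is convex on $[x_{i-1},x_i]$ and $t_i(x)=\min\{h_{i-1}(x),h_i(x)\}$ if $f$ is concave there, and let $s_i(x)=f(x_{i-1})+\frac{f(x_i)-f(x_{i-1})}{x_i-x_{i-1}}(x-x_{i-1})$. Then $$\varepsilon(\mathcal R(f,p))=\max_{i\in\{1,\dots,k\}}\ \max_{x\in[x_{i-1},x_i]}|t_i(x)-s_i(x)|.$$ (Here $\mathcal R(f,p)$ denotes the relaxation of the graph of $f$ consisting of the union over $i$ of the triangles bounded by the graphs of $t_i$ and $s_i$ on $[x_{i-1},x_i]$.) Maximal-bound interval-bisection procedure: $p_0=p_f^0$. Given $p_k$, compute for each sub-interval $[a,b]$ of $p_k$ the number $\frac{(b-a)|f'(a)-f'(b)|}{4}$; choose a sub-interval for which this number is maximal (ties broken arbitrarily), and obtain $p_{k+1}$ from $p_k$ by adding the midpoint of that sub-interval as a new partition point. *)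

theory Defs
  imports "HOL-Analysis.Analysis"
begin

section \<open>Partitions of an interval\<close>

definition interval_partition :: "real \<Rightarrow> real \<Rightarrow> real list \<Rightarrow> bool" where
  "interval_partition l u p \<longleftrightarrow>
     2 \<le> length p \<and> sorted_wrt (<) p \<and> hd p = l \<and> last p = u"

text \<open>A sub-interval \<open>{a..b}\<close> is represented by the pair \<open>(a, b)\<close> of consecutive points.\<close>

definition subintervals :: "real list \<Rightarrow> (real \<times> real) set" where
  "subintervals p = {(p ! i, p ! Suc i) | i. Suc i < length p}"


section \<open>Break points and base partitions\<close>

text \<open>
  An affine function is both convex and concave, so a change of convexity has to be a genuine one:
  the side conditions exclude points of an affine stretch at which nothing changes. If \<open>f\<close> passes
  from convex to concave (or vice versa) through an affine stretch, the change is located at the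
  right end of that stretch, so that each change contributes exactly one break point.
\<close>

definition convex_to_concave_at :: "(real \<Rightarrow> real) \<Rightarrow> real \<Rightarrow> real \<Rightarrow> real \<Rightarrow> bool" where
  "convex_to_concave_at f l u x \<longleftrightarrow>
     (\<exists>a b. l \<le> a \<and> a < x \<and> x < b \<and> b \<le> u \<and>
        convex_on {a..x} f \<and> \<not> concave_on {a..x} f \<and>
        concave_on {x..b} f \<and> (\<forall>y\<in>{x<..b}. \<not> convex_on {x..y} f))"

definition concave_to_convex_at :: "(real \<Rightarrow> real) \<Rightarrow> real \<Rightarrow> real \<Rightarrow> real \<Rightarrow> bool" where
  "concave_to_convex_at f l u x \<longleftrightarrow>
     (\<exists>a b. l \<le> a \<and> a < x \<and> x < b \<and> b \<le> u \<and>
        concave_on {a..x} f \<and> \<not> convex_on {a..x} f \<and>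
        convex_on {x..b} f \<and> (\<forall>y\<in>{x<..b}. \<not> concave_on {x..y} f))"

definition break_points :: "(real \<Rightarrow> real) \<Rightarrow> real \<Rightarrow> real \<Rightarrow> real set" where
  "break_points f l u = {x. convex_to_concave_at f l u x \<or> concave_to_convex_at f l u x}"

text \<open>Throughout, \<open>f'\<close> stands for the derivative of \<open>f\<close> within \<open>{l..u}\<close>.\<close>

definition separating_partition ::
    "(real \<Rightarrow> real) \<Rightarrow> (real \<Rightarrow> real) \<Rightarrow> real \<Rightarrow> real \<Rightarrow> real list \<Rightarrow> bool" where
  "separating_partition f f' l u p \<longleftrightarrow>
     interval_partition l u p \<and> break_points f l u \<subseteq> set p \<and>
     (\<forall>(a, b) \<in> subintervals p. f' a \<noteq> f' b)"

definition minimum_separating_partition ::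
    "(real \<Rightarrow> real) \<Rightarrow> (real \<Rightarrow> real) \<Rightarrow> real \<Rightarrow> real \<Rightarrow> real list \<Rightarrow> bool" where
  "minimum_separating_partition f f' l u p \<longleftrightarrow>
     separating_partition f f' l u p \<and>
     (\<forall>q. separating_partition f f' l u q \<longrightarrow> card (set p) \<le> card (set q))"

text \<open>
  The last conjunct is the rule that singles out one partition of minimum cardinality. The first
  conjunct makes the set of break points finite, so \<open>sorted_list_of_set\<close> lists all of it.
\<close>

definition base_partition ::
    "(real \<Rightarrow> real) \<Rightarrow> (real \<Rightarrow> real) \<Rightarrow> real \<Rightarrow> real \<Rightarrow> real list \<Rightarrow> bool" where
  "base_partition f f' l u p \<longleftrightarrow>
     minimum_separating_partition f f' l u p \<and>
     (let B = break_points f l u \<union> {l, u} in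
        set p = B \<union> {(a + b) / 2 | a b. (a, b) \<in> subintervals (sorted_list_of_set B) \<and> f' a = f' b})"

lemma base_partition_unique:
  assumes "base_partition f f' l u p" "base_partition f f' l u q"
  shows "p = q"
  using assms
  by (auto simp: base_partition_def minimum_separating_partition_def separating_partition_def
      interval_partition_def Let_def intro!: strict_sorted_equal)


section \<open>Strength of the relaxation\<close>

definition tangent :: "(real \<Rightarrow> real) \<Rightarrow> (real \<Rightarrow> real) \<Rightarrow> real \<Rightarrow> real \<Rightarrow> real" where
  "tangent f f' c x = f c + f' c * (x - c)"

text \<open>
  Only used for \<open>f\<close> convex or concave on \<open>{a..b}\<close>; if it is both, the two tangents coincide.
\<close>

definition tangent_envelope ::
    "(real \<Rightarrow> real) \<Rightarrow> (real \<Rightarrow> real) \<Rightarrow> real \<Rightarrow> real \<Rightarrow> real \<Rightarrow> real" where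
  "tangent_envelope f f' a b x =
     (if convex_on {a..b} f then max (tangent f f' a x) (tangent f f' b x)
      else min (tangent f f' a x) (tangent f f' b x))"

definition secant :: "(real \<Rightarrow> real) \<Rightarrow> real \<Rightarrow> real \<Rightarrow> real \<Rightarrow> real" where
  "secant f a b x = f a + (f b - f a) / (b - a) * (x - a)"

text \<open>The supremum is a maximum, see \<open>subinterval_strength_attained\<close> below.\<close>

definition subinterval_strength ::
    "(real \<Rightarrow> real) \<Rightarrow> (real \<Rightarrow> real) \<Rightarrow> real \<Rightarrow> real \<Rightarrow> real" where
  "subinterval_strength f f' a b =
     (SUP x\<in>{a..b}. \<bar>tangent_envelope f f' a b x - secant f a b x\<bar>)"

definition strength :: "(real \<Rightarrow> real) \<Rightarrow> (real \<Rightarrow> real) \<Rightarrow> real list \<Rightarrow> real" where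
  "strength f f' p = Max ((\<lambda>(a, b). subinterval_strength f f' a b) ` subintervals p)"

lemma subinterval_strength_attained:
  assumes "a < b"
  shows "\<exists>x\<in>{a..b}. subinterval_strength f f' a b = \<bar>tangent_envelope f f' a b x - secant f a b x\<bar>
    \<and> (\<forall>y\<in>{a..b}. \<bar>tangent_envelope f f' a b y - secant f a b y\<bar>
                  \<le> \<bar>tangent_envelope f f' a b x - secant f a b x\<bar>)"
proof -
  define g where "g = (\<lambda>x. \<bar>tangent_envelope f f' a b x - secant f a b x\<bar>)"
  have "continuous_on {a..b} g"
    unfolding g_def tangent_envelope_def secant_def tangent_def
    using assms by (cases "convex_on {a..b} f") (auto intro!: continuous_intros)
  then obtain x where x: "x \<in> {a..b}" "\<And>y. y \<in> {a..b} \<Longrightarrow> g y \<le> g x"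
    using continuous_attains_sup[of "{a..b}" g] assms by auto
  have "(SUP y\<in>{a..b}. g y) = g x"
    using x by (intro cSup_eq_maximum) auto
  with x show ?thesis
    unfolding subinterval_strength_def g_def by blast
qed


section \<open>Maximal-bound interval bisection\<close>

definition bisection_bound :: "(real \<Rightarrow> real) \<Rightarrow> real \<Rightarrow> real \<Rightarrow> real" where
  "bisection_bound f' a b = (b - a) * \<bar>f' a - f' b\<bar> / 4"

text \<open>A relation rather than a function, since ties are broken arbitrarily.\<close>

definition bisection_step :: "(real \<Rightarrow> real) \<Rightarrow> real list \<Rightarrow> real list \<Rightarrow> bool" where
  "bisection_step f' p q \<longleftrightarrow>
     (\<exists>(a, b) \<in> subintervals p.
        (\<forall>(c, d) \<in> subintervals p. bisection_bound f' c d \<le> bisection_bound f' a b) \<and>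
        q = insort ((a + b) / 2) p)"

end

theory Submission imports Defs begin

text \<open>
  Write \<open>\<beta> a b = (b - a) * \<bar>f' a - f' b\<bar> / 4\<close> for the bisection bound. Two facts make the theorem
  true. First, where \<open>f\<close> is convex or concave, \<open>\<beta> a b\<close> dominates the strength of the triangle over
  \<open>{a..b}\<close>, because the secant slope lies between the two end slopes, so that the gaps to the two
  tangents share the variation of \<open>f'\<close> (\<open>subinterval_strength_le_bisection_bound\<close>). Second, \<open>f'\<close> is
  monotone there, so the variation of \<open>f'\<close> is additive under subdivision while the width is halved: the bounds of the two halves of an
  interval add up to exactly half of its own bound (\<open>bisection_bound_halves\<close>).

  Consider therefore the sum \<open>\<Phi>\<close> of the bounds over all sub-intervals of a partition. Bisecting an
  interval of maximal bound \<open>M\<close> lowers \<open>\<Phi>\<close> by exactly \<open>M / 2\<close>, and \<open>M\<close> is at least the strength of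
  the current relaxation. As \<open>\<Phi>\<close> is nonnegative, it converges along the procedure, hence its
  decrements tend to zero, and so do \<open>M\<close> and the strength. The lengths of the sub-intervals would be
  the wrong quantity to control: an interval on which \<open>f\<close> is affine has bound zero and may never be
  bisected again.
\<close>

section \<open>Derivatives of convex and concave functions\<close>

text \<open>
  The point of tangency may be an end point of the interval. The difference quotient along the
  segment from \<open>x\<close> to \<open>y\<close> never exceeds its value at \<open>y\<close>, and the inequality survives the limit at \<open>x\<close>.
\<close>

lemma convex_on_above_tangent_closed_interval:
  fixes f :: "real \<Rightarrow> real"
  assumes convex: "convex_on {a..b} f"
    and deriv: "(f has_real_derivative D) (at x within {a..b})"
    and x: "x \<in> {a..b}" and y: "y \<in> {a..b}"
  shows "D * (y - x) \<le> f y - f x"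
proof -
  define g where "g = (\<lambda>t. x + t * (y - x))"
  have g_eq: "g t = (1 - t) *\<^sub>R x + t *\<^sub>R y" for t
    by (simp add: g_def algebra_simps)
  have g_in: "g t \<in> {a..b}" if "t \<in> {0..1}" for t
    unfolding g_eq using convexD_alt[OF convex_real_interval(5) x y, of t] that by simp
  have "(f has_real_derivative D) (at (g 0) within g ` {0..1})"
    by (rule DERIV_subset[of _ _ _ "{a..b}"]) (use deriv g_in in \<open>auto simp: g_def\<close>)
  moreover have "(g has_real_derivative y - x) (at 0 within {0..1})"
    unfolding g_def by (auto intro!: derivative_eq_intros)
  ultimately have "((\<lambda>t. f (g t)) has_real_derivative D * (y - x)) (at 0 within {0..1})"
    using DERIV_image_chain[of f D g 0 "{0..1}" "y - x"] by (simp add: o_def)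
  then have lim: "((\<lambda>t. (f (g t) - f x) / t) \<longlongrightarrow> D * (y - x)) (at 0 within {0..1})"
    by (simp add: has_field_derivative_iff g_def)
  have "(f (g t) - f x) / t \<le> f y - f x" if t: "t \<in> {0..1}" "t \<noteq> 0" for t
  proof -
    have "f (g t) \<le> (1 - t) * f x + t * f y"
      unfolding g_eq using convex_onD[OF convex, of t x y] t x y by simp
    then have "f (g t) - f x \<le> t * (f y - f x)"
      by (simp add: algebra_simps)
    then show ?thesis
      using t by (simp add: divide_le_eq mult.commute)
  qed
  then have "\<forall>\<^sub>F t in at 0 within {0..1}. (f (g t) - f x) / t \<le> f y - f x"
    by (auto simp: eventually_at_filter)
  moreover have "at (0::real) within {0..1} \<noteq> bot"
    by (simp add: trivial_limit_within islimpt_finite)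
  ultimately show ?thesis
    using tendsto_upperbound[OF lim] by blast
qed

lemma convex_on_secant_slope_between:
  fixes f :: "real \<Rightarrow> real"
  assumes "a \<le> b" "convex_on {a..b} f"
    and deriv: "\<And>x. x \<in> {a..b} \<Longrightarrow> (f has_real_derivative f' x) (at x within {a..b})"
  shows "f' a * (b - a) \<le> f b - f a" and "f b - f a \<le> f' b * (b - a)"
  using convex_on_above_tangent_closed_interval[OF assms(2) deriv, of a b]
    convex_on_above_tangent_closed_interval[OF assms(2) deriv, of b a] assms(1)
  by (auto simp: algebra_simps)

lemma convex_on_derivative_mono:
  fixes f :: "real \<Rightarrow> real"
  assumes convex: "convex_on {a..b} f"
    and deriv: "\<And>x. x \<in> {a..b} \<Longrightarrow> (f has_real_derivative f' x) (at x within {a..b})"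
    and "a \<le> c" "c \<le> d" "d \<le> b"
  shows "f' c \<le> f' d"
proof (cases "c = d")
  case False
  have "f' c * (d - c) \<le> f' d * (d - c)"
    using convex_on_above_tangent_closed_interval[OF convex deriv, of c d]
      convex_on_above_tangent_closed_interval[OF convex deriv, of d c] assms(3-5)
    by (auto simp: algebra_simps)
  with False \<open>c \<le> d\<close> show ?thesis by simp
qed simp

lemma derivative_variation_additive:
  fixes f :: "real \<Rightarrow> real"
  assumes shape: "convex_on {a..b} f \<or> concave_on {a..b} f"
    and deriv: "\<And>x. x \<in> {a..b} \<Longrightarrow> (f has_real_derivative f' x) (at x within {a..b})"
    and c: "a \<le> c" "c \<le> b"
  shows "\<bar>f' a - f' c\<bar> + \<bar>f' c - f' b\<bar> = \<bar>f' a - f' b\<bar>"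
  using shape
proof
  assume "convex_on {a..b} f"
  from convex_on_derivative_mono[OF this deriv, of a c] convex_on_derivative_mono[OF this deriv, of c b]
  show ?thesis using c by auto
next
  assume "concave_on {a..b} f"
  then have neg: "convex_on {a..b} (\<lambda>x. - f x)" by (simp add: concave_on_def)
  have neg_deriv: "((\<lambda>x. - f x) has_real_derivative - f' x) (at x within {a..b})"
    if "x \<in> {a..b}" for x
    using deriv[OF that] by (rule DERIV_minus)
  from convex_on_derivative_mono[OF neg neg_deriv, of a c]
    convex_on_derivative_mono[OF neg neg_deriv, of c b]
  show ?thesis using c by auto
qed

lemma bisection_bound_halves:
  fixes f :: "real \<Rightarrow> real"
  assumes "a \<le> b" "convex_on {a..b} f \<or> concave_on {a..b} f"
    and "\<And>x. x \<in> {a..b} \<Longrightarrow> (f has_real_derivative f' x) (at x within {a..b})"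
  shows "bisection_bound f' a ((a + b) / 2) + bisection_bound f' ((a + b) / 2) b
         = bisection_bound f' a b / 2"
proof -
  have "bisection_bound f' a ((a + b) / 2) + bisection_bound f' ((a + b) / 2) b
      = (b - a) / 8 * (\<bar>f' a - f' ((a + b) / 2)\<bar> + \<bar>f' ((a + b) / 2) - f' b\<bar>)"
    by (simp add: bisection_bound_def field_simps)
  also have "\<dots> = (b - a) / 8 * \<bar>f' a - f' b\<bar>"
    using assms by (subst derivative_variation_additive[OF assms(2,3)]) auto
  finally show ?thesis by (simp add: bisection_bound_def)
qed


section \<open>The strength of a triangle\<close>

text \<open>
  The two terms are the gaps between the secant and the tangents at the left and right end point of
  an interval, at distances \<open>v\<close> and \<open>w\<close> from these points; \<open>A\<close> and \<open>B\<close> are the differences between the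
  secant slope and the end slopes. The square of the smaller gap is at most the product of the gaps,
  to which the inequality between arithmetic and geometric mean applies twice.
\<close>

lemma min_mult_le_quarter:
  fixes v w A B :: real
  assumes "0 \<le> v" "0 \<le> w" "0 \<le> A" "0 \<le> B"
  shows "min (v * A) (w * B) \<le> (v + w) * (A + B) / 4"
proof (rule power2_le_imp_le)
  have amgm: "r * s \<le> ((r + s) / 2)\<^sup>2" for r s :: real
    using zero_le_power2[of "r - s"] by (simp add: power2_eq_square field_simps)
  have "(min (v * A) (w * B))\<^sup>2 \<le> (v * A) * (w * B)"
    unfolding power2_eq_square using assms by (intro mult_mono) auto
  also have "\<dots> = (v * w) * (A * B)" by simp
  also have "\<dots> \<le> ((v + w) / 2)\<^sup>2 * ((A + B) / 2)\<^sup>2"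
    using assms by (intro mult_mono amgm) auto
  also have "\<dots> = ((v + w) * (A + B) / 4)\<^sup>2"
    by (simp add: power2_eq_square)
  finally show "(min (v * A) (w * B))\<^sup>2 \<le> ((v + w) * (A + B) / 4)\<^sup>2" .
qed (use assms in simp)

lemma tangent_secant_gap_convex:
  fixes f :: "real \<Rightarrow> real"
  assumes "a < b" "convex_on {a..b} f" "x \<in> {a..b}"
    and deriv: "\<And>x. x \<in> {a..b} \<Longrightarrow> (f has_real_derivative f' x) (at x within {a..b})"
  shows "\<bar>max (tangent f f' a x) (tangent f f' b x) - secant f a b x\<bar> \<le> bisection_bound f' a b"
proof -
  define m where "m = (f b - f a) / (b - a)"
  have m: "f b = f a + m * (b - a)"
    using \<open>a < b\<close> by (simp add: m_def)
  have "f' a \<le> m" "m \<le> f' b"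
    using convex_on_secant_slope_between[OF less_imp_le[OF assms(1)] assms(2) deriv] assms(1)
    by (auto simp: m_def field_simps)
  moreover have left: "tangent f f' a x = secant f a b x - (x - a) * (m - f' a)"
    by (simp add: tangent_def secant_def flip: m_def) (simp add: algebra_simps)
  moreover have right: "tangent f f' b x = secant f a b x - (b - x) * (f' b - m)"
    by (simp add: tangent_def secant_def flip: m_def) (simp add: m algebra_simps)
  moreover have "min ((x - a) * (m - f' a)) ((b - x) * (f' b - m))
      \<le> ((x - a) + (b - x)) * ((m - f' a) + (f' b - m)) / 4"
    using calculation(1,2) assms(3) by (intro min_mult_le_quarter) auto
  moreover have "0 \<le> (x - a) * (m - f' a)" "0 \<le> (b - x) * (f' b - m)"
    using calculation(1,2) assms(3) by auto
  ultimately show ?thesis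
    by (simp add: bisection_bound_def max_def min_def split: if_splits)
qed

lemma subinterval_strength_le_bisection_bound:
  fixes f :: "real \<Rightarrow> real"
  assumes "a < b" and shape: "convex_on {a..b} f \<or> concave_on {a..b} f"
    and deriv: "\<And>x. x \<in> {a..b} \<Longrightarrow> (f has_real_derivative f' x) (at x within {a..b})"
  shows "subinterval_strength f f' a b \<le> bisection_bound f' a b"
  unfolding subinterval_strength_def
proof (rule cSUP_least)
  show "{a..b} \<noteq> {}" using \<open>a < b\<close> by simp
  fix x assume x: "x \<in> {a..b}"
  show "\<bar>tangent_envelope f f' a b x - secant f a b x\<bar> \<le> bisection_bound f' a b"
  proof (cases "convex_on {a..b} f")
    case True
    then show ?thesis
      using tangent_secant_gap_convex[OF \<open>a < b\<close> _ x deriv] by (simp add: tangent_envelope_def)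
  next
    \<comment> \<open>Reflecting \<open>f\<close> turns the minimum of the tangents into a maximum.\<close>
    case False
    with shape have "convex_on {a..b} (\<lambda>x. - f x)" by (simp add: concave_on_def)
    from tangent_secant_gap_convex[OF \<open>a < b\<close> this x DERIV_minus[OF deriv]]
    have "\<bar>max (tangent (\<lambda>x. - f x) (\<lambda>x. - f' x) a x) (tangent (\<lambda>x. - f x) (\<lambda>x. - f' x) b x)
        - secant (\<lambda>x. - f x) a b x\<bar> \<le> bisection_bound (\<lambda>x. - f' x) a b" .
    moreover have "tangent (\<lambda>x. - f x) (\<lambda>x. - f' x) c x = - tangent f f' c x" for c
      by (simp add: tangent_def)
    moreover have "secant (\<lambda>x. - f x) a b x = - secant f a b x"
      using \<open>a < b\<close> by (simp add: secant_def field_simps)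
    moreover have "bisection_bound (\<lambda>x. - f' x) a b = bisection_bound f' a b"
      by (simp add: bisection_bound_def abs_minus_commute)
    ultimately show ?thesis
      using False by (simp add: tangent_envelope_def max_def min_def split: if_splits)
  qed
qed


section \<open>Sub-intervals under insertion of a point\<close>

text \<open>
  For a strictly increasing list, consecutive entries are recognised by the set of entries alone.
  This replaces index arithmetic by set reasoning when a point is inserted.
\<close>

lemma subintervals_strict_sorted:
  assumes "sorted_wrt (<) p"
  shows "subintervals p = {(a, b). a \<in> set p \<and> b \<in> set p \<and> a < b \<and> (\<forall>x\<in>set p. x \<le> a \<or> b \<le> x)}"
    (is "_ = ?R")
proof (intro set_eqI iffI)
  have less_iff: "p ! i < p ! j \<longleftrightarrow> i < j" if "i < length p" "j < length p" for i j
    using sorted_wrt_nth_less[OF assms, of i j] sorted_wrt_nth_less[OF assms, of j i] that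
    by (metis less_asym nat_neq_iff order_less_irrefl)
  fix z
  {
    assume "z \<in> subintervals p"
    then obtain i where "z = (p ! i, p ! Suc i)" and i: "Suc i < length p"
      by (auto simp: subintervals_def)
    moreover have "x \<le> p ! i \<or> p ! Suc i \<le> x" if "x \<in> set p" for x
      using that i by (auto simp: in_set_conv_nth less_iff simp flip: not_less)
    ultimately show "z \<in> ?R" by (auto simp: less_iff)
  next
    assume "z \<in> ?R"
    then obtain i j where z: "z = (p ! i, p ! j)" and ij: "i < length p" "j < length p" "i < j"
      and gap: "\<forall>x\<in>set p. x \<le> p ! i \<or> p ! j \<le> x"
      by (auto simp: in_set_conv_nth less_iff)
    from gap ij have "p ! Suc i \<le> p ! i \<or> p ! j \<le> p ! Suc i" by auto
    with ij have "j = Suc i" by (auto simp: less_iff simp flip: not_less)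
    with z ij show "z \<in> subintervals p" by (auto simp: subintervals_def)
  }
qed

lemma finite_subintervals: "finite (subintervals p)"
proof -
  have "subintervals p = (\<lambda>i. (p ! i, p ! Suc i)) ` {i. Suc i < length p}"
    by (auto simp: subintervals_def)
  moreover have "finite {i. Suc i < length p}"
    by (rule finite_subset[of _ "{..<length p}"]) auto
  ultimately show ?thesis by simp
qed

lemma sorted_wrt_less_insort:
  fixes c :: "'a::linorder"
  assumes "sorted_wrt (<) p" "c \<notin> set p"
  shows "sorted_wrt (<) (insort c p)"
  using assms by (simp add: strict_sorted_iff sorted_insort distinct_insort)

lemma subintervals_insort:
  assumes p: "sorted_wrt (<) p" and ab: "(a, b) \<in> subintervals p" and c: "a < c" "c < b"
  shows "sorted_wrt (<) (insort c p)"
    and "subintervals (insort c p) = insert (a, c) (insert (c, b) (subintervals p - {(a, b)}))"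
    and "(a, c) \<notin> subintervals p" "(c, b) \<notin> subintervals p"
proof -
  have gap: "a \<in> set p" "b \<in> set p" "\<forall>x\<in>set p. x \<le> a \<or> b \<le> x"
    using ab by (auto simp: subintervals_strict_sorted[OF p])
  with c have new: "c \<notin> set p" by force
  then show sorted: "sorted_wrt (<) (insort c p)"
    by (rule sorted_wrt_less_insort[OF p])
  from new show "(a, c) \<notin> subintervals p" "(c, b) \<notin> subintervals p"
    by (auto simp: subintervals_strict_sorted[OF p])
  show "subintervals (insort c p) = insert (a, c) (insert (c, b) (subintervals p - {(a, b)}))"
    unfolding subintervals_strict_sorted[OF p] subintervals_strict_sorted[OF sorted]
    using gap c by (auto simp: set_insort_key) (smt (verit))+
qed


section \<open>The total bound as a potential\<close>

definition total_bound :: "(real \<Rightarrow> real) \<Rightarrow> real list \<Rightarrow> real" where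
  "total_bound f' p = (\<Sum>(a, b)\<in>subintervals p. bisection_bound f' a b)"

text \<open>
  The invariant of the procedure. The derivative is taken within the sub-interval at hand, so that
  every condition on a sub-interval passes to its halves.
\<close>

definition admissible_partition :: "(real \<Rightarrow> real) \<Rightarrow> (real \<Rightarrow> real) \<Rightarrow> real list \<Rightarrow> bool" where
  "admissible_partition f f' p \<longleftrightarrow>
     sorted_wrt (<) p \<and> subintervals p \<noteq> {} \<and>
     (\<forall>(a, b) \<in> subintervals p. (convex_on {a..b} f \<or> concave_on {a..b} f) \<and>
        (\<forall>x\<in>{a..b}. (f has_real_derivative f' x) (at x within {a..b})))"

lemma admissible_partitionD:
  assumes "admissible_partition f f' p" "(a, b) \<in> subintervals p"
  shows "a < b" "convex_on {a..b} f \<or> concave_on {a..b} f"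
    and "\<And>x. x \<in> {a..b} \<Longrightarrow> (f has_real_derivative f' x) (at x within {a..b})"
  using assms by (auto simp: admissible_partition_def subintervals_strict_sorted)

lemma total_bound_nonneg:
  assumes "admissible_partition f f' p"
  shows "0 \<le> total_bound f' p"
  unfolding total_bound_def bisection_bound_def
  using admissible_partitionD(1)[OF assms] by (fastforce intro!: sum_nonneg)

lemma strength_nonneg:
  assumes "admissible_partition f f' p"
  shows "0 \<le> strength f f' p"
proof -
  obtain a b where ab: "(a, b) \<in> subintervals p"
    using assms by (auto simp: admissible_partition_def)
  have "0 \<le> subinterval_strength f f' a b"
    using subinterval_strength_attained[OF admissible_partitionD(1)[OF assms ab], of f f'] by auto
  also have "\<dots> \<le> strength f f' p"
    unfolding strength_def
    using imageI[OF ab, of "\<lambda>(a, b). subinterval_strength f f' a b"]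
    by (intro Max_ge) (simp_all add: finite_subintervals)
  finally show ?thesis .
qed

lemma bisection_step_admissible:
  assumes p: "admissible_partition f f' p" and step: "bisection_step f' p q"
  shows "admissible_partition f f' q"
proof -
  obtain a b where ab: "(a, b) \<in> subintervals p" and q: "q = insort ((a + b) / 2) p"
    using step by (auto simp: bisection_step_def)
  define c where "c = (a + b) / 2"
  have c: "a < c" "c < b"
    using admissible_partitionD(1)[OF p ab] by (auto simp: c_def)
  have sorted: "sorted_wrt (<) p" using p by (simp add: admissible_partition_def)
  note ins = subintervals_insort[OF sorted ab c]
  have sub: "(convex_on {d..e} f \<or> concave_on {d..e} f) \<and>
      (\<forall>x\<in>{d..e}. (f has_real_derivative f' x) (at x within {d..e}))"
    if "{d..e} \<subseteq> {a..b}" for d e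
  proof -
    have "convex_on {d..e} f \<or> concave_on {d..e} f"
      using admissible_partitionD(2)[OF p ab] that
      by (auto simp: concave_on_def intro: convex_on_subset)
    moreover have "(f has_real_derivative f' x) (at x within {d..e})" if "x \<in> {d..e}" for x
      using DERIV_subset[OF admissible_partitionD(3)[OF p ab]] that \<open>{d..e} \<subseteq> {a..b}\<close> by blast
    ultimately show ?thesis by blast
  qed
  have "{a..c} \<subseteq> {a..b}" "{c..b} \<subseteq> {a..b}" using c by auto
  note halves = sub[OF this(1)] sub[OF this(2)]
  show ?thesis
    unfolding admissible_partition_def q c_def[symmetric] ins(2)
    using halves ins(1) p by (auto simp: admissible_partition_def)
qed

text \<open>
  The bisected interval has the largest bound \<open>M\<close>, which dominates the strength on every
  sub-interval; replacing it by its halves takes \<open>M / 2\<close> off the total.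
\<close>

lemma strength_le_total_bound_decrease:
  assumes p: "admissible_partition f f' p" and step: "bisection_step f' p q"
  shows "strength f f' p \<le> 2 * (total_bound f' p - total_bound f' q)"
proof -
  obtain a b where ab: "(a, b) \<in> subintervals p" and q: "q = insort ((a + b) / 2) p"
    and maximal: "\<And>c d. (c, d) \<in> subintervals p \<Longrightarrow> bisection_bound f' c d \<le> bisection_bound f' a b"
    using step unfolding bisection_step_def by blast
  define c where "c = (a + b) / 2"
  note ab_facts = admissible_partitionD[OF p ab]
  have c: "a < c" "c < b"
    using ab_facts(1) by (auto simp: c_def)
  have sorted: "sorted_wrt (<) p" using p by (simp add: admissible_partition_def)
  note ins = subintervals_insort[OF sorted ab c]
  define R where "R = (\<Sum>(d, e)\<in>subintervals p - {(a, b)}. bisection_bound f' d e)"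
  have "strength f f' p \<le> bisection_bound f' a b"
    unfolding strength_def
  proof (rule Max.boundedI)
    fix s assume "s \<in> (\<lambda>(a, b). subinterval_strength f f' a b) ` subintervals p"
    then obtain d e where de: "(d, e) \<in> subintervals p" and s: "s = subinterval_strength f f' d e"
      by auto
    have "s \<le> bisection_bound f' d e"
      unfolding s using admissible_partitionD[OF p de]
      by (rule subinterval_strength_le_bisection_bound)
    also have "\<dots> \<le> bisection_bound f' a b" using maximal[OF de] .
    finally show "s \<le> bisection_bound f' a b" .
  qed (use ab in \<open>auto simp: finite_subintervals\<close>)
  moreover have "total_bound f' p = bisection_bound f' a b + R"
    unfolding total_bound_def R_def by (subst sum.remove[OF finite_subintervals ab]) simp
  moreover have "total_bound f' q = bisection_bound f' a c + (bisection_bound f' c b + R)"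
    unfolding total_bound_def R_def q c_def[symmetric] ins(2)
    using ins(3,4) c by (simp add: finite_subintervals)
  moreover have "bisection_bound f' a c + bisection_bound f' c b = bisection_bound f' a b / 2"
    unfolding c_def using less_imp_le[OF ab_facts(1)] ab_facts(2,3) by (rule bisection_bound_halves)
  ultimately show ?thesis by (simp add: right_diff_distrib)
qed


section \<open>Convergence of maximal-bound interval bisection\<close>

theorem theorem1:
  fixes f f' :: "real \<Rightarrow> real" and l u :: real and p :: "nat \<Rightarrow> real list"
  assumes "l < u"
    and nonlinear: "\<not> (\<exists>c d. \<forall>x\<in>{l..u}. f x = c * x + d)"
    and bdd: "bounded (f ` {l..u})"
    and deriv: "\<And>x. x \<in> {l..u} \<Longrightarrow> (f has_real_derivative f' x) (at x within {l..u})"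
    and base: "base_partition f f' l u (p 0)"
    and shape: "\<And>a b. (a, b) \<in> subintervals (p 0) \<Longrightarrow> convex_on {a..b} f \<or> concave_on {a..b} f"
    and step: "\<And>k. bisection_step f' (p k) (p (Suc k))"
  shows "(\<lambda>k. strength f f' (p k)) \<longlonglongrightarrow> 0"
proof -
  have "interval_partition l u (p 0)"
    using base
    by (simp add: base_partition_def minimum_separating_partition_def separating_partition_def)
  then have sorted: "sorted_wrt (<) (p 0)" and len: "2 \<le> length (p 0)"
    and ends: "hd (p 0) = l" "last (p 0) = u"
    by (auto simp: interval_partition_def)
  have range: "l \<le> x \<and> x \<le> u" if x: "x \<in> set (p 0)" for x
  proof -
    have "sorted (p 0)" using sorted by (simp add: strict_sorted_iff)
    moreover have "p 0 \<noteq> []" using len by auto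
    moreover obtain i where "i < length (p 0)" "x = p 0 ! i"
      using x by (auto simp: in_set_conv_nth)
    ultimately show ?thesis
      using ends sorted_nth_mono[of "p 0" 0 i] sorted_nth_mono[of "p 0" i "length (p 0) - 1"]
      by (auto simp: hd_conv_nth last_conv_nth)
  qed
  have "(f has_real_derivative f' x) (at x within {a..b})"
    if "(a, b) \<in> subintervals (p 0)" "x \<in> {a..b}" for a b x
  proof -
    have "{a..b} \<subseteq> {l..u}"
      using that(1) range[of a] range[of b] by (auto simp: subintervals_strict_sorted[OF sorted])
    with deriv that(2) show ?thesis by (blast intro: DERIV_subset)
  qed
  moreover have "subintervals (p 0) \<noteq> {}"
    using len by (auto simp: subintervals_def intro!: exI[of _ 0])
  ultimately have "admissible_partition f f' (p 0)"
    using sorted by (auto simp: admissible_partition_def dest: shape)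
  then have adm: "admissible_partition f f' (p k)" for k
    by (induction k) (use step bisection_step_admissible in blast)+
  define \<Phi> where "\<Phi> = (\<lambda>k. total_bound f' (p k))"
  have bound: "strength f f' (p k) \<le> 2 * (\<Phi> k - \<Phi> (Suc k))" for k
    unfolding \<Phi>_def by (rule strength_le_total_bound_decrease[OF adm step])
  have "decseq \<Phi>"
  proof (rule decseq_SucI)
    show "\<Phi> (Suc k) \<le> \<Phi> k" for k
      using bound[of k] strength_nonneg[OF adm[of k]] by simp
  qed
  moreover have "0 \<le> \<Phi> k" for k
    unfolding \<Phi>_def by (rule total_bound_nonneg[OF adm])
  ultimately obtain L where L: "\<Phi> \<longlonglongrightarrow> L"
    using decseq_convergent[of \<Phi> 0] by blast
  have "(\<lambda>k. 2 * (\<Phi> k - \<Phi> (Suc k))) \<longlonglongrightarrow> 2 * (L - L)"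
    by (intro tendsto_intros L LIMSEQ_Suc)
  then have lim: "(\<lambda>k. 2 * (\<Phi> k - \<Phi> (Suc k))) \<longlonglongrightarrow> 0" by simp
  show ?thesis
    by (rule tendsto_sandwich[OF _ _ tendsto_const lim])
      (use bound strength_nonneg[OF adm] in auto)
qed

end
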